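(* Let $p_0,p_1,q_0,q_1\in(0,\infty)$ satisfy $p_0\neq p_1$, $q_0\neq q_1$, $q_0\leq p_0$ and $q_1\leq p_1$. Take $r\in(0,\infty]$ and $\kappa\in(0,1)$, and set $p,q$ by $$(p^{-1},q^{-1})=(1-\kappa)(p_0^{-1},q_0^{-1})+\kappa(p_1^{-1},q_1^{-1}).$$ Then $q\leq p$ holds and the embedding $$\left(M^{p_0}_{q_0,r_0},M^{p_1}_{q_1,r_1}\right)_{\kappa,r}\subset M^p_{q,r}$$ is valid for all $r_0,r_1\in(0,\infty]$.
   Context: Lorentz spaces on $\mathbb{R}^N$: for measurable $f:\mathbb{R}^N\to\mathbb{R}$ put $\alpha_f(\sigma)=|\{x:|f(x)|>\sigma\}|$ ($\sigma>0$) and $f^*(\lambda)=\sup\{\sigma>0:\alpha_f(\sigma)>\lambda\}$ ($\sup\varnothing=0$). For $0<p<\infty$, $0<q\le\infty$, $\|f\|_{L^{p,q}}=\left(\int_0^\infty(\lambda^{1/p}f^*(\lambda))^q\,\frac{d\lambda}{\lambda}\right)^{1/q}$ if $q<\infty$, and $\|f\|_{L^{p,\infty}}=\sup_{\lambda>0}\lambda^{1/p}f^*(\lambda)$. Local Lorentz--Morrey spaces: for $0<q\le p<\infty$, $\kappa\in(0,\infty]$, $M^p_{q,\kappa}=M^p_{q,\kappa}(\mathbb{R}^N)$ is the set of measurable $f$ with $\|f\|_{M^p_{q,\kappa}}=\sup_{0<R\le1}\sup_{z\in\mathbb{R}^N}R^{N/p-N/q}\|f\chi_{B(z,R)}\|_{L^{q,\kappa}(\mathbb{R}^N)}<\infty$.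 Real interpolation: for quasi-normed spaces $X_0,X_1$ contained in a common Hausdorff topological vector space, $f\in X_0+X_1$ and $\lambda>0$, $K(f,\lambda;X_0,X_1)=\inf\{\|f_0\|_{X_0}+\lambda\|f_1\|_{X_1}: f=f_0+f_1,\ f_i\in X_i\}$. For $\kappa\in(0,1)$, $r\in(0,\infty]$, $(X_0,X_1)_{\kappa,r}$ is the set of $f\in X_0+X_1$ for which $\left(\int_0^\infty(\lambda^{-\kappa}K(f,\lambda;X_0,X_1))^r\,\frac{d\lambda}{\lambda}\right)^{1/r}$ ($r<\infty$), resp. $\sup_{\lambda>0}\lambda^{-\kappa}K(f,\lambda;X_0,X_1)$ ($r=\infty$), is finite; this quantity is its quasi-norm. Embeddings are continuous, i.e. with a quasi-norm inequality. *)

theory Defs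
  imports "HOL-Analysis.Analysis" "HOL-Library.Function_Algebras"
begin

text \<open>Powers with a positive real exponent on the extended half-line, so that infinity is
  mapped to infinity (this is only used with a > 0).\<close>

definition epowr :: "ennreal \<Rightarrow> real \<Rightarrow> ennreal" where
  "epowr x a = (if x = \<infinity> then \<infinity> else ennreal (enn2real x powr a))"

text \<open>The quasi-norm of \<open>L\<^sup>r((0,\<infinity>), dt/t)\<close>; for r infinite it is the true supremum over t > 0,
  not an essential supremum.\<close>

definition Lr_haar :: "ennreal \<Rightarrow> (real \<Rightarrow> ennreal) \<Rightarrow> ennreal" where
  "Lr_haar r g =
     (if r = \<infinity> then (SUP t\<in>{0<..}. g t)
      else epowr (\<integral>\<^sup>+t\<in>{0<..}. epowr (g t) (enn2real r) * ennreal (1 / t) \<partial>lborel)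
             (1 / enn2real r))"


section \<open>Real interpolation\<close>

text \<open>A quasi-normed space is given by its carrier together with its quasi-norm. For function
  spaces the elements are functions rather than classes modulo null sets, and addition is pointwise.
  For norms that depend only on the a.e. class and are defined on Lebesgue measurable functions this
  yields the same K-functional as working with classes: if \<open>f = f\<^sub>0 + f\<^sub>1\<close> holds only a.e., then
  \<open>f\<^sub>0\<close> may be replaced by \<open>f - f\<^sub>1\<close>.\<close>

type_synonym 'v qspace = "'v set \<times> ('v \<Rightarrow> ennreal)"

abbreviation carr :: "'v qspace \<Rightarrow> 'v set" where
  "carr X \<equiv> fst X"

abbreviation qnorm :: "'v qspace \<Rightarrow> 'v \<Rightarrow> ennreal" where
  "qnorm X \<equiv> snd X"

definition K_functional :: "'v::ab_group_add qspace \<Rightarrow> 'v qspace \<Rightarrow> 'v \<Rightarrow> real \<Rightarrow> ennreal" where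
  "K_functional X0 X1 f t =
     Inf {qnorm X0 f0 + ennreal t * qnorm X1 f1 | f0 f1.
            f0 \<in> carr X0 \<and> f1 \<in> carr X1 \<and> f = f0 + f1}"

definition interp_norm ::
  "'v::ab_group_add qspace \<Rightarrow> 'v qspace \<Rightarrow> real \<Rightarrow> ennreal \<Rightarrow> 'v \<Rightarrow> ennreal" where
  "interp_norm X0 X1 \<kappa> r f =
     Lr_haar r (\<lambda>t. ennreal (t powr (- \<kappa>)) * K_functional X0 X1 f t)"

definition real_interp ::
  "'v::ab_group_add qspace \<Rightarrow> 'v qspace \<Rightarrow> real \<Rightarrow> ennreal \<Rightarrow> 'v qspace" where
  "real_interp X0 X1 \<kappa> r =
     ({f. (\<exists>f0\<in>carr X0. \<exists>f1\<in>carr X1. f = f0 + f1) \<and> interp_norm X0 X1 \<kappa> r f < \<infinity>},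
      interp_norm X0 X1 \<kappa> r)"

definition cont_embedded :: "'v qspace \<Rightarrow> 'v qspace \<Rightarrow> bool" where
  "cont_embedded X Y \<longleftrightarrow>
     carr X \<subseteq> carr Y \<and> (\<exists>C::real. \<forall>f\<in>carr X. qnorm Y f \<le> ennreal C * qnorm X f)"


section \<open>Lorentz and local Lorentz--Morrey spaces\<close>

definition distr_fun :: "(real^'n \<Rightarrow> real) \<Rightarrow> real \<Rightarrow> ennreal" where
  "distr_fun f \<sigma> = emeasure lebesgue {x. \<bar>f x\<bar> > \<sigma>}"

text \<open>The supremum is taken in the extended half-line, so the supremum of the empty set is 0.\<close>

definition rearr :: "(real^'n \<Rightarrow> real) \<Rightarrow> real \<Rightarrow> ennreal" where
  "rearr f t = Sup {ennreal \<sigma> | \<sigma>. \<sigma> > 0 \<and> distr_fun f \<sigma> > ennreal t}"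

definition lorentz_norm :: "real \<Rightarrow> ennreal \<Rightarrow> (real^'n \<Rightarrow> real) \<Rightarrow> ennreal" where
  "lorentz_norm p q f = Lr_haar q (\<lambda>t. ennreal (t powr (1 / p)) * rearr f t)"

definition lorentz_morrey_norm ::
  "real \<Rightarrow> real \<Rightarrow> ennreal \<Rightarrow> (real^'n \<Rightarrow> real) \<Rightarrow> ennreal" where
  "lorentz_morrey_norm p q \<kappa> f =
     (SUP R\<in>{0<..1}. SUP z.
        ennreal (R powr (real CARD('n) / p - real CARD('n) / q)) *
        lorentz_norm q \<kappa> (\<lambda>x. f x * indicator (ball z R) x))"

definition lorentz_morrey :: "real \<Rightarrow> real \<Rightarrow> ennreal \<Rightarrow> (real^'n \<Rightarrow> real) qspace" where
  "lorentz_morrey p q \<kappa> =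
     ({f. f \<in> borel_measurable lebesgue \<and> lorentz_morrey_norm p q \<kappa> f < \<infinity>},
      lorentz_morrey_norm p q \<kappa>)"

end

theory Submission
  imports Defs
begin

text \<open>Write \<open>a\<^sub>i = N/q\<^sub>i - N/p\<^sub>i\<close>, \<open>a = N/q - N/p\<close>, \<open>d = 1/q\<^sub>0 - 1/q\<^sub>1\<close>, and let \<open>\<phi>\<close> be the indicator of a
  ball of radius \<open>R\<close>. Lorentz norms dominate weak norms, so
  \<open>(f\<^sub>i \<phi>)\<^sup>*(t) \<le> C t powr (-1/q\<^sub>i) R powr a\<^sub>i \<parallel>f\<^sub>i\<parallel>\<close> whatever the second Lorentz exponents are.
  Adding these bounds at \<open>t/2\<close> and taking the infimum over \<open>f = f\<^sub>0 + f\<^sub>1\<close> gives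
  \<open>(f \<phi>)\<^sup>*(t) \<le> C t powr (-1/q\<^sub>0) R powr a\<^sub>0 K(f, u)\<close> with \<open>u = R powr (a\<^sub>1 - a\<^sub>0) t powr d\<close>.
  As \<open>1/q = 1/q\<^sub>0 - \<kappa> d\<close> and \<open>a = a\<^sub>0 + \<kappa> (a\<^sub>1 - a\<^sub>0)\<close>, this reads
  \<open>R powr (-a) t powr (1/q) (f \<phi>)\<^sup>*(t) \<le> C u powr (-\<kappa>) K(f, u)\<close>, and since \<open>d \<noteq> 0\<close> the substitution
  \<open>t \<mapsto> u\<close> only multiplies \<open>dt/t\<close> by a constant that does not depend on \<open>R\<close>.\<close>


section \<open>Powers on the extended half-line\<close>

lemma epowr_ennreal [simp]: "0 \<le> x \<Longrightarrow> epowr (ennreal x) a = ennreal (x powr a)"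
  by (simp add: epowr_def)

lemma epowr_top [simp]: "epowr top a = top"
  by (simp add: epowr_def)

lemma epowr_mono:
  assumes "0 \<le> a" "x \<le> y"
  shows "epowr x a \<le> epowr y a"
  using assms by (cases x; cases y) (auto simp: powr_mono2 top_unique ennreal_le_iff)

lemma epowr_epowr: "epowr (epowr x a) b = epowr x (a * b)"
  by (cases x) (simp_all add: powr_powr)

lemma epowr_one [simp]: "epowr x 1 = x"
  by (cases x) simp_all

lemma epowr_cmult:
  assumes "0 < c"
  shows "epowr (ennreal c * x) a = ennreal (c powr a) * epowr x a"
  using assms by (cases x) (auto simp: powr_mult ennreal_mult_top simp flip: ennreal_mult)

lemma borel_measurable_epowr [measurable (raw)]:
  assumes [measurable]: "f \<in> borel_measurable M"
  shows "(\<lambda>x. epowr (f x) a) \<in> borel_measurable M"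
  unfolding epowr_def by measurable

text \<open>Both powers of \<open>t\<close> are finite and mutually inverse, so the factor can
  change sides even when \<open>x\<close> or \<open>y\<close> is infinite.\<close>

lemma ennreal_powr_le_mult_iff:
  assumes "0 < t"
  shows "x \<le> ennreal (t powr a) * y \<longleftrightarrow> ennreal (t powr - a) * x \<le> y"
proof
  assume "x \<le> ennreal (t powr a) * y"
  then have "ennreal (t powr - a) * x \<le> ennreal (t powr - a) * (ennreal (t powr a) * y)"
    by (rule mult_left_mono) simp
  also have "\<dots> = y"
    using assms by (simp add: mult.assoc[symmetric] powr_add[symmetric] flip: ennreal_mult)
  finally show "ennreal (t powr - a) * x \<le> y" .
next
  assume "ennreal (t powr - a) * x \<le> y"
  then have "ennreal (t powr a) * (ennreal (t powr - a) * x) \<le> ennreal (t powr a) * y"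
    by (rule mult_left_mono) simp
  also have "ennreal (t powr a) * (ennreal (t powr - a) * x) = x"
    using assms by (simp add: mult.assoc[symmetric] powr_add[symmetric] flip: ennreal_mult)
  finally show "x \<le> ennreal (t powr a) * y" .
qed

text \<open>Superlevel sets of a monotone function are intervals.\<close>

lemma borel_measurable_mono_ennreal:
  fixes f :: "real \<Rightarrow> ennreal"
  assumes "mono f"
  shows "f \<in> borel_measurable borel"
proof (rule borel_measurableI_greater)
  fix y
  have "is_interval {x. y < f x}"
    unfolding is_interval_1 using monoD[OF assms] by (auto intro: less_le_trans)
  then show "{x \<in> space borel. y < f x} \<in> sets borel"
    by (simp add: real_interval_borel_measurable)
qed


section \<open>The norm of \<open>L\<^sup>r\<close> with respect to \<open>dt/t\<close>\<close>

text \<open>This is the substitution t = exp u, which turns dt/t into du. The substitution rule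
  applied below is for compact intervals, so the measures are compared on the intervals
  \<open>I n\<close> and the general case follows by exhaustion.\<close>

lemma haar_eq_distr_exp:
  "density lborel (\<lambda>t. ennreal (1 / t) * indicator {0<..} t) = distr lborel borel (exp :: real \<Rightarrow> real)"
    (is "?D = ?E")
proof (rule measure_eqI)
  show "sets ?D = sets ?E" by simp
  fix A assume "A \<in> sets ?D"
  then have A[measurable]: "A \<in> sets borel" by simp
  define I where "I n = {exp (- real n)..exp (real n)}" for n
  have [measurable]: "I n \<in> sets borel" for n
    by (simp add: I_def)
  have inc: "incseq (\<lambda>n. A \<inter> I n)"
  proof (rule incseq_SucI)
    show "A \<inter> I n \<subseteq> A \<inter> I (Suc n)" for n
      by (auto simp: I_def elim!: order_trans[rotated] order_trans)
  qed
  have UN: "(\<Union>n. A \<inter> I n) = A \<inter> {0<..}"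
  proof (intro equalityI subsetI)
    fix t assume t: "t \<in> A \<inter> {0<..}"
    obtain n where "\<bar>ln t\<bar> \<le> real n"
      using real_arch_simple by blast
    then have "exp (- real n) \<le> exp (ln t)" "exp (ln t) \<le> exp (real n)"
      unfolding exp_le_cancel_iff by auto
    moreover have "exp (ln t) = t"
      using t by simp
    ultimately have "t \<in> I n"
      by (simp only: I_def atLeastAtMost_iff)
    then show "t \<in> (\<Union>n. A \<inter> I n)"
      using t by auto
  qed (auto simp: I_def intro: less_le_trans[OF exp_gt_zero])
  \<comment> \<open>The sets \<open>A \<inter> I n\<close> exhaust only the positive part of
    \<open>A\<close>. The rest is null for both measures: the density vanishes there and
    \<open>exp\<close> has positive values.\<close>
  have D: "emeasure ?D (A \<inter> {0<..}) = emeasure ?D A"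
    by (simp add: emeasure_density) (auto intro!: nn_integral_cong simp: indicator_def)
  have E: "emeasure ?E (A \<inter> {0<..}) = emeasure ?E A"
    by (simp add: emeasure_distr) (auto intro!: arg_cong[where f = "emeasure _"])
  have sets: "range (\<lambda>n. A \<inter> I n) \<subseteq> sets borel"
    by (intro image_subsetI) measurable
  have "emeasure ?D (A \<inter> I n) = emeasure ?E (A \<inter> I n)" for n
  proof -
    have "emeasure ?D (A \<inter> I n) = (\<integral>\<^sup>+t. ennreal (indicator A t / t) * indicator (I n) t \<partial>lborel)"
      by (simp add: emeasure_density)
        (auto intro!: nn_integral_cong simp: I_def indicator_def
          intro: less_le_trans[OF exp_gt_zero])
    also have "\<dots> = (\<integral>\<^sup>+t. ennreal (indicator A t / t * indicator (I n) t) \<partial>lborel)"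
      by (auto intro!: nn_integral_cong simp: indicator_def)
    also have "\<dots> = (\<integral>\<^sup>+u. ennreal (indicator A (exp u) / exp u * exp u * indicator {- real n..real n} u) \<partial>lborel)"
      unfolding I_def
      by (rule nn_integral_substitution)
        (auto intro!: derivative_eq_intros continuous_intros simp: set_borel_measurable_def)
    also have "\<dots> = (\<integral>\<^sup>+u. indicator (exp -` (A \<inter> I n)) u \<partial>lborel)"
      by (auto intro!: nn_integral_cong simp: indicator_def I_def)
    also have "\<dots> = emeasure ?E (A \<inter> I n)"
      by (simp add: emeasure_distr measurable_sets_borel[OF borel_measurable_exp])
    finally show ?thesis .
  qed
  moreover have "(SUP n. emeasure ?D (A \<inter> I n)) = emeasure ?D A"
  proof -
    have "(SUP n. emeasure ?D (A \<inter> I n)) = emeasure ?D (\<Union>n. A \<inter> I n)"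
      by (rule SUP_emeasure_incseq[OF _ inc]) (use sets in simp)
    then show ?thesis
      unfolding UN D .
  qed
  moreover have "(SUP n. emeasure ?E (A \<inter> I n)) = emeasure ?E A"
  proof -
    have "(SUP n. emeasure ?E (A \<inter> I n)) = emeasure ?E (\<Union>n. A \<inter> I n)"
      by (rule SUP_emeasure_incseq[OF _ inc]) (use sets in simp)
    then show ?thesis
      unfolding UN E .
  qed
  ultimately show "emeasure ?D A = emeasure ?E A"
    by simp
qed

lemma nn_integral_haar_exp:
  assumes [measurable]: "F \<in> borel_measurable borel"
  shows "(\<integral>\<^sup>+t\<in>{0<..}. F t * ennreal (1 / t) \<partial>lborel) = (\<integral>\<^sup>+u. F (exp u) \<partial>lborel)"
proof -
  have "(\<integral>\<^sup>+t\<in>{0<..}. F t * ennreal (1 / t) \<partial>lborel) =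
      (\<integral>\<^sup>+t. F t \<partial>density lborel (\<lambda>t. ennreal (1 / t) * indicator {0<..} t))"
    by (simp add: nn_integral_density mult_ac)
  also have "\<dots> = (\<integral>\<^sup>+u. F (exp u) \<partial>lborel)"
    by (simp add: haar_eq_distr_exp nn_integral_distr)
  finally show ?thesis .
qed

text \<open>In the variable u = ln t the map is affine, u to ln c + d u. The shift ln c leaves
  Lebesgue measure unchanged, so only the factor 1/|d| remains, for either sign of
  \<open>d\<close>.\<close>

lemma nn_integral_haar_substitution:
  fixes c d :: real
  assumes [measurable]: "F \<in> borel_measurable borel" and "0 < c" "d \<noteq> 0"
  shows "(\<integral>\<^sup>+t\<in>{0<..}. F (c * t powr d) * ennreal (1 / t) \<partial>lborel) =
    ennreal (1 / \<bar>d\<bar>) * (\<integral>\<^sup>+t\<in>{0<..}. F t * ennreal (1 / t) \<partial>lborel)"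
proof -
  have "(\<integral>\<^sup>+t\<in>{0<..}. F (c * t powr d) * ennreal (1 / t) \<partial>lborel) =
      (\<integral>\<^sup>+u. F (c * exp u powr d) \<partial>lborel)"
    by (rule nn_integral_haar_exp) simp
  also have "\<dots> = (\<integral>\<^sup>+u. F (exp (ln c + d * u)) \<partial>lborel)"
    using \<open>0 < c\<close> by (simp add: powr_def exp_add)
  also have "\<dots> = ennreal (1 / \<bar>d\<bar>) * (\<integral>\<^sup>+u. F (exp u) \<partial>lborel)"
    using \<open>d \<noteq> 0\<close>
    by (subst nn_integral_real_affine[of "\<lambda>u. F (exp u)" d "ln c"])
      (simp_all add: mult.assoc[symmetric] flip: ennreal_mult)
  finally show ?thesis
    by (simp add: nn_integral_haar_exp)
qed

lemma Lr_haar_mono: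
  assumes "\<And>t. 0 < t \<Longrightarrow> g t \<le> h t"
  shows "Lr_haar r g \<le> Lr_haar r h"
proof (cases "r = \<infinity>")
  case True
  with assms show ?thesis
    by (auto simp: Lr_haar_def intro!: SUP_mono)
next
  case False
  have "(\<integral>\<^sup>+t\<in>{0<..}. epowr (g t) (enn2real r) * ennreal (1 / t) \<partial>lborel) \<le>
      (\<integral>\<^sup>+t\<in>{0<..}. epowr (h t) (enn2real r) * ennreal (1 / t) \<partial>lborel)"
    by (intro nn_integral_mono)
      (auto simp: indicator_def intro!: mult_right_mono epowr_mono assms)
  with False show ?thesis
    by (auto simp: Lr_haar_def intro!: epowr_mono)
qed

text \<open>For infinite \<open>r\<close> the conventions \<open>enn2real \<infinity> = 0\<close>
  and \<open>1 / 0 = 0\<close> make the constant equal to 1, as it should be for a supremum over a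
  reparametrised half-line.\<close>

lemma Lr_haar_substitution:
  fixes c d :: real
  assumes [measurable]: "G \<in> borel_measurable borel" and "0 < c" "d \<noteq> 0"
  shows "Lr_haar r (\<lambda>t. G (c * t powr d)) \<le> ennreal (\<bar>d\<bar> powr (- 1 / enn2real r)) * Lr_haar r G"
proof (cases "r = \<infinity>")
  case True
  then show ?thesis
    using assms by (auto simp: Lr_haar_def intro!: SUP_least SUP_upper)
next
  case False
  have "epowr (ennreal (1 / \<bar>d\<bar>) * x) (1 / enn2real r) =
      ennreal (\<bar>d\<bar> powr (- 1 / enn2real r)) * epowr x (1 / enn2real r)" for x
    using \<open>d \<noteq> 0\<close> by (subst epowr_cmult) (auto simp: powr_minus_divide powr_divide)
  with False show ?thesis
    using assms by (simp add: Lr_haar_def nn_integral_haar_substitution[where F = "\<lambda>t. epowr (G t) _"])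
qed

lemma Lr_haar_cmult:
  assumes [measurable]: "G \<in> borel_measurable borel" and "0 < c" "0 < r"
  shows "Lr_haar r (\<lambda>t. ennreal c * G t) = ennreal c * Lr_haar r G"
proof (cases "r = \<infinity>")
  case True
  then show ?thesis
    by (simp add: Lr_haar_def SUP_mult_left_ennreal)
next
  case False
  then have r: "0 < enn2real r"
    using \<open>0 < r\<close> by (simp add: enn2real_positive_iff top.not_eq_extremum)
  have "(\<integral>\<^sup>+t\<in>{0<..}. epowr (ennreal c * G t) (enn2real r) * ennreal (1 / t) \<partial>lborel) =
      ennreal (c powr enn2real r) * (\<integral>\<^sup>+t\<in>{0<..}. epowr (G t) (enn2real r) * ennreal (1 / t) \<partial>lborel)"
    using \<open>0 < c\<close> by (simp add: epowr_cmult mult.assoc nn_integral_cmult)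
  with False r \<open>0 < c\<close> show ?thesis
    by (simp add: Lr_haar_def epowr_cmult powr_powr)
qed


section \<open>Rearrangements and Lorentz norms\<close>

lemma rearr_antimono: "s \<le> t \<Longrightarrow> rearr f t \<le> rearr f s"
  unfolding rearr_def by (rule Sup_subset_mono) (auto intro: le_less_trans ennreal_leI)

text \<open>Otherwise \<open>a\<close> would be one of the levels in the supremum defining
  \<open>rearr f t\<close>.\<close>

lemma distr_fun_le_of_rearr_less:
  assumes "rearr f t < ennreal a"
  shows "distr_fun f a \<le> ennreal t"
proof (rule ccontr)
  assume "\<not> ?thesis"
  moreover have "0 < a"
    using assms by (metis ennreal_less_zero_iff gr_zeroI not_less_zero)
  ultimately have "ennreal a \<le> rearr f t"
    unfolding rearr_def by (intro Sup_upper) auto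
  with assms show False by simp
qed

text \<open>Where |f + g| exceeds \<open>c\<close>, either |f| exceeds \<open>a\<close> or |g|
  exceeds \<open>b\<close>.\<close>

lemma distr_fun_add_le:
  assumes [measurable]: "f \<in> borel_measurable lebesgue" "g \<in> borel_measurable lebesgue"
    and "a + b \<le> c"
  shows "distr_fun (\<lambda>x. f x + g x) c \<le> distr_fun f a + distr_fun g b"
proof -
  have [measurable]: "{x. a < \<bar>f x\<bar>} \<in> sets lebesgue" "{x. b < \<bar>g x\<bar>} \<in> sets lebesgue"
    using measurable_sets[of "\<lambda>x. \<bar>f x\<bar>" lebesgue borel "{a<..}"]
      measurable_sets[of "\<lambda>x. \<bar>g x\<bar>" lebesgue borel "{b<..}"] by (auto simp: vimage_def)
  have "emeasure lebesgue {x. c < \<bar>f x + g x\<bar>} \<le> emeasure lebesgue ({x. a < \<bar>f x\<bar>} \<union> {x. b < \<bar>g x\<bar>})"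
    using \<open>a + b \<le> c\<close> by (intro emeasure_mono) auto
  also have "\<dots> \<le> emeasure lebesgue {x. a < \<bar>f x\<bar>} + emeasure lebesgue {x. b < \<bar>g x\<bar>}"
    by (rule emeasure_subadditive) auto
  finally show ?thesis
    by (simp add: distr_fun_def)
qed

lemma rearr_add_le:
  assumes "f \<in> borel_measurable lebesgue" "g \<in> borel_measurable lebesgue" "0 \<le> t"
  shows "rearr (\<lambda>x. f x + g x) t \<le> rearr f (t / 2) + rearr g (t / 2)"
proof (rule ccontr)
  assume "\<not> ?thesis"
  then obtain \<sigma> where \<sigma>: "0 < \<sigma>" "ennreal t < distr_fun (\<lambda>x. f x + g x) \<sigma>"
    and less: "rearr f (t / 2) + rearr g (t / 2) < ennreal \<sigma>"
    unfolding rearr_def[of "\<lambda>x. f x + g x"] by (auto simp: not_le less_Sup_iff)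
  obtain A B where A: "rearr f (t / 2) = ennreal A" "0 \<le> A" and B: "rearr g (t / 2) = ennreal B" "0 \<le> B"
    using less by (cases "rearr f (t / 2)"; cases "rearr g (t / 2)") auto
  have AB: "A + B < \<sigma>"
    using less A B by (simp flip: ennreal_plus add: ennreal_less_iff)
  \<comment> \<open>The distribution functions are controlled only at levels strictly above
    \<open>A\<close> and \<open>B\<close>, so the gap below \<open>\<sigma>\<close> is shared
    equally between the two.\<close>
  define e where "e = (\<sigma> - A - B) / 2"
  have "0 < e" "(A + e) + (B + e) \<le> \<sigma>"
    using AB by (auto simp: e_def field_simps)
  then have "distr_fun (\<lambda>x. f x + g x) \<sigma> \<le> distr_fun f (A + e) + distr_fun g (B + e)"
    using assms by (intro distr_fun_add_le)
  also have "\<dots> \<le> ennreal (t / 2) + ennreal (t / 2)"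
    using A B \<open>0 < e\<close> by (intro add_mono distr_fun_le_of_rearr_less) (auto simp: ennreal_less_iff)
  also have "\<dots> = ennreal t"
    using \<open>0 \<le> t\<close> by (simp flip: ennreal_plus)
  finally show False
    using \<sigma> by simp
qed

text \<open>For finite \<open>r\<close>, bound the integral from below by the part over \<open>[t/2, t]\<close>, where the
  rearrangement is at least its value at \<open>t\<close>.\<close>

lemma lorentz_norm_ge_weak:
  assumes "0 < q" "0 < r"
  obtains D where "0 < D"
    "\<And>(f :: real^'n \<Rightarrow> real) t. 0 < t \<Longrightarrow> rearr f t \<le> ennreal (D * t powr (- (1 / q))) * lorentz_norm q r f"
proof (cases "r = \<infinity>")
  case True
  have "rearr f t \<le> ennreal (1 * t powr (- (1 / q))) * lorentz_norm q r f"
    if "0 < t" for f :: "real^'n \<Rightarrow> real" and t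
    using that True
    by (subst mult_1, subst ennreal_powr_le_mult_iff)
      (auto simp: lorentz_norm_def Lr_haar_def intro!: SUP_upper)
  then show ?thesis
    by (intro that[of 1]) auto
next
  case False
  define \<rho> where "\<rho> = enn2real r"
  have \<rho>: "0 < \<rho>"
    using \<open>0 < r\<close> False by (simp add: \<rho>_def enn2real_positive_iff top.not_eq_extremum)
  \<comment> \<open>The first factor comes from replacing the weight by its value at
    \<open>t/2\<close>. The second is the \<rho>-th root of 1/2, the interval length
    \<open>t/2\<close> times the lower bound \<open>1/t\<close> for the density.\<close>
  define k where "k = (1 / 2) powr (1 / q) * (1 / 2) powr (1 / \<rho>)"
  have "0 < k"
    by (simp add: k_def)
  have "rearr f t \<le> ennreal (1 / k * t powr (- (1 / q))) * lorentz_norm q r f"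
    if t: "0 < t" for f :: "real^'n \<Rightarrow> real" and t
  proof -
    define y where "y = ennreal ((t / 2) powr (1 / q)) * rearr f t"
    have "epowr y \<rho> * ennreal (1 / 2) = (\<integral>\<^sup>+s. epowr y \<rho> * ennreal (1 / t) * indicator {t/2..t} s \<partial>lborel)"
    proof -
      have "ennreal (1 / t) * emeasure lborel {t/2..t} = ennreal (1 / t * (t - t / 2))"
        using t by (subst ennreal_mult) simp_all
      also have "1 / t * (t - t / 2) = 1 / 2"
        using t by (simp add: field_simps)
      finally show ?thesis
        by (subst nn_integral_cmult_indicator) (simp_all only: mult.assoc, simp)
    qed
    also have "\<dots> \<le> (\<integral>\<^sup>+s\<in>{0<..}. epowr (ennreal (s powr (1 / q)) * rearr f s) \<rho> * ennreal (1 / s) \<partial>lborel)"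
    proof (intro nn_integral_mono)
      fix s
      show "epowr y \<rho> * ennreal (1 / t) * indicator {t/2..t} s \<le>
          epowr (ennreal (s powr (1 / q)) * rearr f s) \<rho> * ennreal (1 / s) * indicator {0<..} s"
      proof (cases "s \<in> {t/2..t}")
        case True
        then have "y \<le> ennreal (s powr (1 / q)) * rearr f s"
          unfolding y_def using t \<open>0 < q\<close>
          by (intro mult_mono ennreal_leI powr_mono2 rearr_antimono) auto
        with True t \<rho> show ?thesis
          by (auto intro!: mult_mono epowr_mono ennreal_leI simp: frac_le)
      qed simp
    qed
    finally have "epowr (epowr y \<rho> * ennreal (1 / 2)) (1 / \<rho>) \<le> lorentz_norm q r f"
      using False \<rho> by (auto simp: lorentz_norm_def Lr_haar_def \<rho>_def intro!: epowr_mono)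
    moreover have "epowr (epowr y \<rho> * ennreal (1 / 2)) (1 / \<rho>) = ennreal ((1 / 2) powr (1 / \<rho>)) * y"
      unfolding mult.commute[of _ "ennreal (1 / 2)"]
      by (subst epowr_cmult) (use \<rho> in \<open>auto simp: epowr_epowr\<close>)
    ultimately have "ennreal ((1 / 2) powr (1 / \<rho>)) * y \<le> lorentz_norm q r f"
      by (simp only:)
    moreover have "ennreal ((1 / 2) powr (1 / \<rho>)) * y = ennreal (k * t powr (1 / q)) * rearr f t"
    proof -
      have "(1 / 2) powr (1 / \<rho>) * (t / 2) powr (1 / q) = k * t powr (1 / q)"
        using t powr_mult[of "1 / 2" t "1 / q"] by (simp add: k_def)
      then show ?thesis
        by (simp add: y_def mult.assoc[symmetric] flip: ennreal_mult)
    qed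
    ultimately have "ennreal (1 / k * t powr (- (1 / q))) * (ennreal (k * t powr (1 / q)) * rearr f t)
        \<le> ennreal (1 / k * t powr (- (1 / q))) * lorentz_norm q r f"
      by (intro mult_left_mono) auto
    moreover have "1 / k * t powr (- (1 / q)) * (k * t powr (1 / q)) = 1"
      using t \<open>0 < k\<close> by (simp add: powr_minus field_simps)
    ultimately show ?thesis
      using \<open>0 < k\<close> by (simp add: mult.assoc[symmetric] flip: ennreal_mult)
  qed
  with \<open>0 < k\<close> show ?thesis
    by (intro that[of "1 / k"]) auto
qed

text \<open>A single ball is one competitor in the Morrey supremum. The power of \<open>t\<close>
  does not involve the second exponent \<open>r\<close>, which is why \<open>r0\<close> and
  \<open>r1\<close> can be arbitrary in the theorem.\<close>

lemma rearr_ball_le_lorentz_morrey: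
  assumes "0 < q" "0 < r"
  obtains D where "0 < D"
    "\<And>(f :: real^'n \<Rightarrow> real) t z R. 0 < t \<Longrightarrow> 0 < R \<Longrightarrow> R \<le> 1 \<Longrightarrow>
      rearr (\<lambda>x. f x * indicator (ball z R) x) t \<le>
      ennreal (D * t powr (- (1 / q)) * R powr (real CARD('n) / q - real CARD('n) / p))
        * lorentz_morrey_norm p q r f"
proof -
  obtain D where D: "0 < D"
    "\<And>(f :: real^'n \<Rightarrow> real) t. 0 < t \<Longrightarrow> rearr f t \<le> ennreal (D * t powr (- (1 / q))) * lorentz_norm q r f"
    using lorentz_norm_ge_weak[OF assms] by blast
  have "rearr (\<lambda>x. f x * indicator (ball z R) x) t \<le>
      ennreal (D * t powr (- (1 / q)) * R powr (real CARD('n) / q - real CARD('n) / p))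
        * lorentz_morrey_norm p q r f" (is "?L \<le> _")
    if "0 < t" "0 < R" "R \<le> 1" for f :: "real^'n \<Rightarrow> real" and t z R
  proof -
    define a where "a = real CARD('n) / q - real CARD('n) / p"
    have "ennreal (R powr - a) * lorentz_norm q r (\<lambda>x. f x * indicator (ball z R) x)
        \<le> lorentz_morrey_norm p q r f"
      unfolding lorentz_morrey_norm_def a_def using that
      by (intro SUP_upper2[where i = R] SUP_upper2[where i = z]) auto
    then have "lorentz_norm q r (\<lambda>x. f x * indicator (ball z R) x)
        \<le> ennreal (R powr a) * lorentz_morrey_norm p q r f"
      by (simp add: ennreal_powr_le_mult_iff \<open>0 < R\<close>)
    then have "ennreal (D * t powr (- (1 / q))) * lorentz_norm q r (\<lambda>x. f x * indicator (ball z R) x)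
        \<le> ennreal (D * t powr (- (1 / q))) * (ennreal (R powr a) * lorentz_morrey_norm p q r f)"
      by (rule mult_left_mono) simp
    with D(2)[OF \<open>0 < t\<close>, of "\<lambda>x. f x * indicator (ball z R) x"] show ?thesis
      unfolding a_def[symmetric] using D(1)
      by (simp add: ennreal_mult mult.assoc)
  qed
  with D(1) show ?thesis
    using that by blast
qed


section \<open>The K-functional\<close>

lemma K_functional_mono:
  assumes "s \<le> t"
  shows "K_functional X0 X1 f s \<le> K_functional X0 X1 f t"
proof -
  have "x + ennreal s * y \<le> x + ennreal t * y" for x y
    using assms by (intro add_left_mono mult_right_mono ennreal_leI) auto
  then show ?thesis
    unfolding K_functional_def by (intro Inf_mono) blast
qed

text \<open>The infimum runs over a possibly uncountable family of decompositions; measurability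
  comes from monotonicity in \<open>t\<close> instead.\<close>

lemma borel_measurable_K_functional [measurable]:
  "K_functional X0 X1 f \<in> borel_measurable borel"
  by (intro borel_measurable_mono_ennreal monoI K_functional_mono)

text \<open>Moving the constant to the left leaves a plain lower bound for an infimum. If there is
  no decomposition, the infimum is infinite and the bound is trivial.\<close>

lemma le_mult_K_functional:
  assumes "0 < c"
    and "\<And>f0 f1. f0 \<in> carr X0 \<Longrightarrow> f1 \<in> carr X1 \<Longrightarrow> f = f0 + f1 \<Longrightarrow>
      x \<le> ennreal c * (qnorm X0 f0 + ennreal t * qnorm X1 f1)"
  shows "x \<le> ennreal c * K_functional X0 X1 f t"
proof -
  \<comment> \<open>The exponent 1 only serves to write \<open>c\<close> in the form that the
    equivalence expects.\<close>
  have "x \<le> ennreal (c powr 1) * y \<longleftrightarrow> ennreal (c powr - 1) * x \<le> y" for y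
    using \<open>0 < c\<close> by (rule ennreal_powr_le_mult_iff)
  with assms show ?thesis
    unfolding K_functional_def by (auto intro!: Inf_greatest)
qed

lemma rearr_ball_le_K_functional:
  fixes p0 p1 q0 q1 :: real
  assumes "0 < q0" "0 < q1" "0 < r0" "0 < r1"
  obtains C where "0 < C"
    "\<And>(f :: real^'n \<Rightarrow> real) t z R. 0 < t \<Longrightarrow> 0 < R \<Longrightarrow> R \<le> 1 \<Longrightarrow>
      rearr (\<lambda>x. f x * indicator (ball z R) x) t \<le>
      ennreal (C * t powr (- (1 / q0)) * R powr (real CARD('n) / q0 - real CARD('n) / p0)) *
        K_functional (lorentz_morrey p0 q0 r0) (lorentz_morrey p1 q1 r1) f
          (t powr (1 / q0 - 1 / q1) *
           R powr ((real CARD('n) / q1 - real CARD('n) / p1) - (real CARD('n) / q0 - real CARD('n) / p0)))"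
proof -
  define a0 a1 where "a0 = real CARD('n) / q0 - real CARD('n) / p0"
    and "a1 = real CARD('n) / q1 - real CARD('n) / p1"
  obtain D0 where D0: "0 < D0"
    "\<And>(f :: real^'n \<Rightarrow> real) t z R. 0 < t \<Longrightarrow> 0 < R \<Longrightarrow> R \<le> 1 \<Longrightarrow>
      rearr (\<lambda>x. f x * indicator (ball z R) x) t \<le>
      ennreal (D0 * t powr (- (1 / q0)) * R powr a0) * lorentz_morrey_norm p0 q0 r0 f"
    unfolding a0_def using rearr_ball_le_lorentz_morrey[OF assms(1,3)] by blast
  obtain D1 where D1: "0 < D1"
    "\<And>(f :: real^'n \<Rightarrow> real) t z R. 0 < t \<Longrightarrow> 0 < R \<Longrightarrow> R \<le> 1 \<Longrightarrow>
      rearr (\<lambda>x. f x * indicator (ball z R) x) t \<le>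
      ennreal (D1 * t powr (- (1 / q1)) * R powr a1) * lorentz_morrey_norm p1 q1 r1 f"
    unfolding a1_def using rearr_ball_le_lorentz_morrey[OF assms(2,4)] by blast
  \<comment> \<open>The powers of 1/2 appear because both summands are estimated at
    \<open>t/2\<close>; the sum dominates both coefficients.\<close>
  define C where "C = D0 * (1 / 2) powr (- (1 / q0)) + D1 * (1 / 2) powr (- (1 / q1))"
  have C: "0 < C" "D0 * (1 / 2) powr (- (1 / q0)) \<le> C" "D1 * (1 / 2) powr (- (1 / q1)) \<le> C"
    using D0(1) D1(1) by (auto simp: C_def intro!: add_pos_pos)
  have "rearr (\<lambda>x. f x * indicator (ball z R) x) t \<le> ennreal (C * t powr (- (1 / q0)) * R powr a0) *
      K_functional (lorentz_morrey p0 q0 r0) (lorentz_morrey p1 q1 r1) f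
        (t powr (1 / q0 - 1 / q1) * R powr (a1 - a0))"
    if t: "0 < t" and R: "0 < R" "R \<le> 1" for f :: "real^'n \<Rightarrow> real" and t z R
  proof (rule le_mult_K_functional)
    show "0 < C * t powr (- (1 / q0)) * R powr a0"
      using t R C by simp
    fix f0 f1 :: "real^'n \<Rightarrow> real"
    assume "f0 \<in> carr (lorentz_morrey p0 q0 r0)" "f1 \<in> carr (lorentz_morrey p1 q1 r1)"
    then have [measurable]: "f0 \<in> borel_measurable lebesgue" "f1 \<in> borel_measurable lebesgue"
      by (auto simp: lorentz_morrey_def)
    assume f: "f = f0 + f1"
    define \<phi> :: "real^'n \<Rightarrow> real" where "\<phi> = indicator (ball z R)"
    have [measurable]: "\<phi> \<in> borel_measurable lebesgue"
      unfolding \<phi>_def by (intro borel_measurable_indicator) simp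
    define N0 N1 where "N0 = lorentz_morrey_norm p0 q0 r0 f0" and "N1 = lorentz_morrey_norm p1 q1 r1 f1"
    define c where "c = C * t powr (- (1 / q0)) * R powr a0"
    \<comment> \<open>Apart from constants, \<open>u\<close> is the weight of the \<open>f1\<close>
      bound divided by that of the \<open>f0\<close> bound. Factoring out \<open>c\<close> therefore
      leaves exactly an expression of the K-functional at \<open>u\<close>.\<close>
    define u where "u = t powr (1 / q0 - 1 / q1) * R powr (a1 - a0)"
    have "rearr (\<lambda>x. f x * \<phi> x) t = rearr (\<lambda>x. f0 x * \<phi> x + f1 x * \<phi> x) t"
      by (simp add: f distrib_right)
    also have "\<dots> \<le> rearr (\<lambda>x. f0 x * \<phi> x) (t / 2) + rearr (\<lambda>x. f1 x * \<phi> x) (t / 2)"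
      using t by (intro rearr_add_le) auto
    also have "\<dots> \<le> ennreal (D0 * (t / 2) powr (- (1 / q0)) * R powr a0) * N0 +
        ennreal (D1 * (t / 2) powr (- (1 / q1)) * R powr a1) * N1"
      unfolding \<phi>_def N0_def N1_def using t R by (intro add_mono D0(2) D1(2)) auto
    also have "\<dots> \<le> ennreal c * N0 + ennreal (c * u) * N1"
    proof (intro add_mono mult_right_mono ennreal_leI)
      have half: "(t / 2) powr e = (1 / 2) powr e * t powr e" for e
        using t powr_mult[of "1 / 2" t e] by simp
      show "D0 * (t / 2) powr (- (1 / q0)) * R powr a0 \<le> c"
        unfolding c_def half mult.assoc[symmetric] by (intro mult_right_mono C) auto
      have "c * u = C * (t powr (- (1 / q0)) * t powr (1 / q0 - 1 / q1)) * (R powr a0 * R powr (a1 - a0))"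
        by (simp add: c_def u_def)
      also have "\<dots> = C * t powr (- (1 / q1)) * R powr a1"
        using t R by (simp flip: powr_add)
      finally show "D1 * (t / 2) powr (- (1 / q1)) * R powr a1 \<le> c * u"
        unfolding half mult.assoc[symmetric] by (simp only:) (intro mult_right_mono C; simp)
    qed auto
    also have "\<dots> = ennreal c * (N0 + ennreal u * N1)"
      using C by (simp add: distrib_left ennreal_mult c_def u_def mult.assoc)
    finally show "rearr (\<lambda>x. f x * indicator (ball z R) x) t \<le>
        ennreal c * (qnorm (lorentz_morrey p0 q0 r0) f0 + ennreal u * qnorm (lorentz_morrey p1 q1 r1) f1)"
      by (simp add: lorentz_morrey_def N0_def N1_def \<phi>_def)
  qed
  with C(1) show ?thesis
    using that unfolding a0_def a1_def by blast
qed

text \<open>The estimate is proved ball by ball, with a constant independent of \<open>R\<close> and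
  \<open>z\<close>. The radius enters the substitution only as the dilation \<open>c\<close>, to
  which dt/t is invariant.\<close>

lemma lorentz_morrey_norm_le_interp_norm:
  fixes p0 p1 q0 q1 p q \<kappa> :: real and r r0 r1 :: ennreal
  assumes "0 < q0" "0 < q1" "q0 \<noteq> q1" "0 < r" "0 < r0" "0 < r1"
    and p: "inverse p = (1 - \<kappa>) * inverse p0 + \<kappa> * inverse p1"
    and q: "inverse q = (1 - \<kappa>) * inverse q0 + \<kappa> * inverse q1"
  obtains C where "\<And>f :: real^'n \<Rightarrow> real. lorentz_morrey_norm p q r f \<le>
      ennreal C * interp_norm (lorentz_morrey p0 q0 r0) (lorentz_morrey p1 q1 r1) \<kappa> r f"
proof -
  define N where "N = real CARD('n)"
  define a0 a1 a d where "a0 = N / q0 - N / p0" and "a1 = N / q1 - N / p1"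
    and "a = N / q - N / p" and "d = 1 / q0 - 1 / q1"
  \<comment> \<open>The assumption \<open>q0 \<noteq> q1\<close> enters here; it makes t to
    \<open>c * t powr d\<close> a change of variables.\<close>
  have "d \<noteq> 0"
    using assms by (simp add: d_def)
  \<comment> \<open>The exponent is linear in the pair (1/p, 1/q), so it interpolates with the same
    parameter \<kappa>.\<close>
  have "a = N * (inverse q - inverse p)"
    by (simp add: a_def field_simps)
  also have "\<dots> = a0 + \<kappa> * (a1 - a0)"
    unfolding p q a0_def a1_def by (simp add: divide_inverse algebra_simps)
  finally have a: "a = a0 + \<kappa> * (a1 - a0)" .
  have qd: "1 / q = 1 / q0 - \<kappa> * d"
    using q by (simp add: d_def divide_inverse algebra_simps)
  obtain C where C: "0 < C"
    "\<And>(f :: real^'n \<Rightarrow> real) t z R. 0 < t \<Longrightarrow> 0 < R \<Longrightarrow> R \<le> 1 \<Longrightarrow>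
      rearr (\<lambda>x. f x * indicator (ball z R) x) t \<le> ennreal (C * t powr (- (1 / q0)) * R powr a0) *
        K_functional (lorentz_morrey p0 q0 r0) (lorentz_morrey p1 q1 r1) f (t powr d * R powr (a1 - a0))"
    using rearr_ball_le_K_functional[OF assms(1,2,5,6), where ?'n = 'n, of p0 p1]
    unfolding a0_def a1_def d_def N_def by blast
  \<comment> \<open>The pointwise constant times the factor from the substitution.\<close>
  define E where "E = C * \<bar>d\<bar> powr (- 1 / enn2real r)"
  have "lorentz_morrey_norm p q r f \<le>
      ennreal E * interp_norm (lorentz_morrey p0 q0 r0) (lorentz_morrey p1 q1 r1) \<kappa> r f"
    for f :: "real^'n \<Rightarrow> real"
    unfolding lorentz_morrey_norm_def
  proof (intro SUP_least)
    fix R :: real and z :: "real^'n"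
    assume "R \<in> {0<..1}"
    then have R: "0 < R" "R \<le> 1" by auto
    define K where "K = K_functional (lorentz_morrey p0 q0 r0) (lorentz_morrey p1 q1 r1) f"
    have [measurable]: "K \<in> borel_measurable borel"
      by (simp add: K_def)
    define G where "G t = ennreal (t powr - \<kappa>) * K t" for t
    have [measurable]: "G \<in> borel_measurable borel"
      unfolding G_def by measurable
    define c where "c = R powr (a1 - a0)"
    have "0 < c"
      using R by (simp add: c_def)
    have *: "lorentz_norm q r (\<lambda>x. f x * indicator (ball z R) x) \<le>
        Lr_haar r (\<lambda>t. ennreal (C * R powr a) * G (c * t powr d))"
      unfolding lorentz_norm_def
    proof (rule Lr_haar_mono)
      fix t :: real assume t: "0 < t"
      have "ennreal (t powr (1 / q)) * rearr (\<lambda>x. f x * indicator (ball z R) x) t \<le>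
          ennreal (t powr (1 / q)) * (ennreal (C * t powr (- (1 / q0)) * R powr a0) * K (c * t powr d))"
        using C(2)[OF t R, of f z] by (intro mult_left_mono) (auto simp: K_def c_def mult.commute)
      also have "\<dots> = ennreal (t powr (1 / q) * (C * t powr (- (1 / q0)) * R powr a0)) * K (c * t powr d)"
        using C(1) by (simp add: ennreal_mult mult.assoc)
      \<comment> \<open>Since 1/q - 1/q0 = -\<kappa> d and a0 - a = -\<kappa> (a1 - a0), splitting
        off \<open>R powr a\<close> leaves precisely the interpolation weight at
        \<open>c * t powr d\<close>.\<close>
      also have "t powr (1 / q) * (C * t powr (- (1 / q0)) * R powr a0) =
          C * R powr a * (c * t powr d) powr - \<kappa>"
      proof -
        have 1: "t powr (1 / q) * (C * t powr (- (1 / q0)) * R powr a0) = C * R powr a0 * t powr (- \<kappa> * d)"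
          unfolding qd by (simp add: mult_ac flip: powr_add)
        have 2: "(c * t powr d) powr - \<kappa> = R powr (- \<kappa> * (a1 - a0)) * t powr (- \<kappa> * d)"
          using t R by (simp add: c_def powr_mult powr_powr mult.commute)
        have 3: "R powr a * R powr (- \<kappa> * (a1 - a0)) = R powr a0"
          unfolding a by (simp flip: powr_add)
        show ?thesis
          unfolding 1 unfolding 2 3[symmetric] by (simp only: mult.assoc)
      qed
      also have "ennreal \<dots> * K (c * t powr d) = ennreal (C * R powr a) * G (c * t powr d)"
        using C(1) by (simp add: G_def ennreal_mult mult.assoc)
      finally show "ennreal (t powr (1 / q)) * rearr (\<lambda>x. f x * indicator (ball z R) x) t \<le>
          ennreal (C * R powr a) * G (c * t powr d)" .
    qed
    also have "\<dots> = ennreal (C * R powr a) * Lr_haar r (\<lambda>t. G (c * t powr d))"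
      using R C(1) \<open>0 < r\<close> by (intro Lr_haar_cmult) auto
    also have "\<dots> \<le> ennreal (C * R powr a) * (ennreal (\<bar>d\<bar> powr (- 1 / enn2real r)) * Lr_haar r G)"
      using \<open>0 < c\<close> \<open>d \<noteq> 0\<close> by (intro mult_left_mono Lr_haar_substitution) auto
    also have "\<dots> = ennreal (R powr a) * (ennreal E * Lr_haar r G)"
      using C(1) by (simp add: E_def ennreal_mult mult_ac)
    finally have "ennreal (R powr - a) * lorentz_norm q r (\<lambda>x. f x * indicator (ball z R) x) \<le>
        ennreal E * Lr_haar r G"
      by (simp add: ennreal_powr_le_mult_iff \<open>0 < R\<close>)
    then show "ennreal (R powr (real CARD('n) / p - real CARD('n) / q)) *
        lorentz_norm q r (\<lambda>x. f x * indicator (ball z R) x) \<le>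
        ennreal E * interp_norm (lorentz_morrey p0 q0 r0) (lorentz_morrey p1 q1 r1) \<kappa> r f"
      by (simp add: interp_norm_def G_def[abs_def] K_def a_def N_def)
  qed
  then show ?thesis
    using that by blast
qed

theorem proposition2p8:
  fixes p0 p1 q0 q1 p q \<kappa> :: real and r :: ennreal
  assumes "p0 > 0" "p1 > 0" "q0 > 0" "q1 > 0"
    and "p0 \<noteq> p1" "q0 \<noteq> q1" "q0 \<le> p0" "q1 \<le> p1"
    and "r > 0" "0 < \<kappa>" "\<kappa> < 1"
    and "inverse p = (1 - \<kappa>) * inverse p0 + \<kappa> * inverse p1"
    and "inverse q = (1 - \<kappa>) * inverse q0 + \<kappa> * inverse q1"
  shows "q \<le> p \<and>
    (\<forall>r0 r1 :: ennreal. r0 > 0 \<longrightarrow> r1 > 0 \<longrightarrow>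
       cont_embedded
         (real_interp (lorentz_morrey p0 q0 r0) (lorentz_morrey p1 q1 r1) \<kappa> r)
         (lorentz_morrey p q r :: (real^'n \<Rightarrow> real) qspace))"
proof (intro conjI allI impI)
  have "inverse p \<le> inverse q"
    using assms by (auto intro!: add_mono mult_left_mono le_imp_inverse_le)
  \<comment> \<open>Because \<open>p\<close> is given only through its inverse and
    \<open>inverse 0 = 0\<close>, positivity has to be secured before inverting the
    inequality.\<close>
  moreover have "0 < inverse p"
    using assms by (auto intro!: add_pos_pos)
  ultimately show "q \<le> p"
    by (simp add: inverse_le_imp_le)
next
  fix r0 r1 :: ennreal assume "r0 > 0" "r1 > 0"
  then obtain C where C: "\<And>f :: real^'n \<Rightarrow> real. lorentz_morrey_norm p q r f \<le>
      ennreal C * interp_norm (lorentz_morrey p0 q0 r0) (lorentz_morrey p1 q1 r1) \<kappa> r f"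
    using lorentz_morrey_norm_le_interp_norm[OF assms(3,4,6,9) _ _ assms(12,13)] by blast
  have "carr (real_interp (lorentz_morrey p0 q0 r0) (lorentz_morrey p1 q1 r1) \<kappa> r) \<subseteq>
      carr (lorentz_morrey p q r :: (real^'n \<Rightarrow> real) qspace)"
  proof
    fix f :: "real^'n \<Rightarrow> real"
    assume "f \<in> carr (real_interp (lorentz_morrey p0 q0 r0) (lorentz_morrey p1 q1 r1) \<kappa> r)"
    then obtain f0 f1 where f: "f = f0 + f1"
      and [measurable]: "f0 \<in> borel_measurable lebesgue" "f1 \<in> borel_measurable lebesgue"
      and fin: "interp_norm (lorentz_morrey p0 q0 r0) (lorentz_morrey p1 q1 r1) \<kappa> r f < \<infinity>"
      by (auto simp: real_interp_def lorentz_morrey_def)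
    \<comment> \<open>Measurability comes from the decomposition of \<open>f\<close>, as the norm
      inequality alone does not provide it.\<close>
    have "f \<in> borel_measurable lebesgue"
      unfolding f plus_fun_def by measurable
    moreover have "lorentz_morrey_norm p q r f < \<infinity>"
      using C[of f] fin by (auto intro: le_less_trans simp: ennreal_mult_less_top)
    ultimately show "f \<in> carr (lorentz_morrey p q r)"
      by (simp add: lorentz_morrey_def)
  qed
  with C show "cont_embedded
      (real_interp (lorentz_morrey p0 q0 r0) (lorentz_morrey p1 q1 r1) \<kappa> r)
      (lorentz_morrey p q r :: (real^'n \<Rightarrow> real) qspace)"
    by (auto simp: cont_embedded_def real_interp_def lorentz_morrey_def)
qed

end
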